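(* Let $\mathcal{I}=\bigl(([s_i,e_i))_{i\in[n]},q,\mathcal{S}\bigr)$ be an instance of the extended version with an arbitrary set $\mathcal{S}$ of non-overlapping schedules, such that $|U(\mathcal{I})|=q$, i.e., there are exactly $q$ indices $i$ with $0\in[s_i,e_i)$. The following statements are equivalent: (a') There exists a feasible assignment $f$ and a worker $j$ performing each task at least once (for each $i\in[n]$ there is $r$ with $f(i,r)=j$). (b') There exists a balanced feasible assignment. (c') There exists a balanced feasible assignment that is periodic with period at most $q^2\,q!$.
   Context: Tasks: $n$ intervals $[s_i,e_i)\subseteq(-1,1)$, $i\in[n]$, with $e_i\in(0,1]$, $e_i-s_i\le 1$; the $r$th occurrence ($r\in\mathbb{Z}_{>0}$) of task $i$ occupies $[s_i+r,e_i+r)$; $q$ is a positive integer and workers are identified with $[q]$. Let $U(\mathcal{I})=\{i\in[n]: s_i\le 0\}$. A schedule is a pair $(T,W)$ with $T\subseteq[n]$ and either $W=\varnothing$ or $W=\{i\}$ with $i\in U(\mathcal{I})$. It is non-overlapping if for all $i'\in T$: $[s_{i'},e_{i'})\cap[s_{i''},e_{i''})=\varnothing$ for all $i''\in T\setminus\{i'\}$, and $[s_{i'},e_{i'})\cap[s_i+1,e_i+1)=\varnothing$ for all $i\in W$. An instance of the extended version is a triple $\bigl(([s_i,e_i))_{i\in[n]},q,\mathcal{S}\bigr)$ where $\mathcal{S}$ is a set of non-overlapping schedules. An assignment is a map $f:[n]\times\mathbb{Z}_{>0}\to[q]$. For a worker $j$ and week $r\in\mathbb{Z}_{>0}$, the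 schedule induced by $f$ is $(T,W)$ with $T=\{i\in[n]: f(i,r)=j\}$ and $W=\{i\in U(\mathcal{I}): f(i,r+1)=j\}$. An assignment is feasible if all the schedules it induces belong to $\mathcal{S}$. It is balanced if for every $i\in[n]$, $j\in[q]$ the limit $\lim_{t\to\infty}\frac1t|\{r\in[t]:f(i,r)=j\}|$ exists and equals $1/q$. It is periodic with period $h$ if $f(i,r)=f(i,r+h)$ for all $i,r$. *)

theory Defs
  imports Complex_Main "HOL-Library.FuncSet"
begin

text \<open>
  Tasks are indexed by \<open>{1..n}\<close>, workers by \<open>{1..q}\<close> and weeks by the positive naturals.
  Task \<open>i\<close> is the interval \<open>[s i, e i)\<close>; values of \<open>s\<close> and \<open>e\<close> outside \<open>{1..n}\<close> are irrelevant.
\<close>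

definition valid_tasks :: "nat \<Rightarrow> (nat \<Rightarrow> real) \<Rightarrow> (nat \<Rightarrow> real) \<Rightarrow> bool" where
  "valid_tasks n s e \<longleftrightarrow>
     (\<forall>i\<in>{1..n}. {s i..<e i} \<subseteq> {-1<..<1} \<and> e i \<in> {0<..1} \<and> e i - s i \<le> 1)"

definition U_set :: "nat \<Rightarrow> (nat \<Rightarrow> real) \<Rightarrow> nat set" where
  "U_set n s = {i \<in> {1..n}. s i \<le> 0}"

lemma U_set_iff_zero_mem:
  assumes "valid_tasks n s e"
  shows "U_set n s = {i \<in> {1..n}. 0 \<in> {s i..<e i}}"
  using assms by (auto simp: U_set_def valid_tasks_def)

type_synonym schedule = "nat set \<times> nat set"

definition is_schedule :: "nat \<Rightarrow> (nat \<Rightarrow> real) \<Rightarrow> schedule \<Rightarrow> bool" where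
  "is_schedule n s = (\<lambda>(T, W). T \<subseteq> {1..n} \<and> (W = {} \<or> (\<exists>i\<in>U_set n s. W = {i})))"

definition non_overlapping :: "(nat \<Rightarrow> real) \<Rightarrow> (nat \<Rightarrow> real) \<Rightarrow> schedule \<Rightarrow> bool" where
  "non_overlapping s e = (\<lambda>(T, W). \<forall>i'\<in>T.
     (\<forall>i''\<in>T - {i'}. {s i'..<e i'} \<inter> {s i''..<e i''} = {}) \<and>
     (\<forall>i\<in>W. {s i'..<e i'} \<inter> {s i + 1..<e i + 1} = {}))"

definition extended_instance ::
  "nat \<Rightarrow> (nat \<Rightarrow> real) \<Rightarrow> (nat \<Rightarrow> real) \<Rightarrow> nat \<Rightarrow> schedule set \<Rightarrow> bool" where
  "extended_instance n s e q S \<longleftrightarrow>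
     valid_tasks n s e \<and> q > 0 \<and> (\<forall>\<sigma>\<in>S. is_schedule n s \<sigma> \<and> non_overlapping s e \<sigma>)"

definition assignment :: "nat \<Rightarrow> nat \<Rightarrow> (nat \<times> nat \<Rightarrow> nat) \<Rightarrow> bool" where
  "assignment n q f \<longleftrightarrow> f \<in> {1..n} \<times> {1..} \<rightarrow> {1..q}"

definition induced_schedule ::
  "nat \<Rightarrow> (nat \<Rightarrow> real) \<Rightarrow> (nat \<times> nat \<Rightarrow> nat) \<Rightarrow> nat \<Rightarrow> nat \<Rightarrow> schedule" where
  "induced_schedule n s f j r =
     ({i \<in> {1..n}. f (i, r) = j}, {i \<in> U_set n s. f (i, r + 1) = j})"

definition feasible ::
  "nat \<Rightarrow> (nat \<Rightarrow> real) \<Rightarrow> nat \<Rightarrow> schedule set \<Rightarrow> (nat \<times> nat \<Rightarrow> nat) \<Rightarrow> bool" where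
  "feasible n s q S f \<longleftrightarrow> (\<forall>j\<in>{1..q}. \<forall>r\<ge>1. induced_schedule n s f j r \<in> S)"

definition balanced :: "nat \<Rightarrow> nat \<Rightarrow> (nat \<times> nat \<Rightarrow> nat) \<Rightarrow> bool" where
  "balanced n q f \<longleftrightarrow> (\<forall>i\<in>{1..n}. \<forall>j\<in>{1..q}.
     (\<lambda>t. 1 / real t * real (card {r \<in> {1..t}. f (i, r) = j})) \<longlonglongrightarrow> 1 / real q)"

definition periodic :: "nat \<Rightarrow> (nat \<times> nat \<Rightarrow> nat) \<Rightarrow> nat \<Rightarrow> bool" where
  "periodic n f h \<longleftrightarrow> h > 0 \<and> (\<forall>i\<in>{1..n}. \<forall>r\<ge>1. f (i, r) = f (i, r + h))"

end

theory Submission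
  imports Defs "Graph_Theory.Euler"
begin

text \<open>
  Since \<open>|U| = q\<close> and the tasks of \<open>U\<close> pairwise overlap at time 0, every week of a feasible
  assignment restricts to a bijection from \<open>U\<close> to the workers. Up to renaming workers, week \<open>w\<close>
  is therefore a pattern consisting of a map from the tasks to \<open>U\<close> and a permutation \<open>d w\<close> of
  \<open>U\<close> describing the passage to the next week, and any sequence of patterns, started from any
  bijection, yields a feasible assignment.

  Let worker \<open>j\<close> perform all tasks and keep one week for each pair of consecutive elements of
  \<open>U\<close> visited by \<open>j\<close>; these are at most \<open>q\<^sup>2\<close> weeks \<open>R\<close>. Let \<open>V\<close> be the orbit of a bijection
  under the permutations of the weeks in \<open>R\<close>, so \<open>|V| \<le> q!\<close>. Joining each \<open>\<pi> \<in> V\<close> to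
  \<open>\<pi> \<circ> d w\<close> for each \<open>w \<in> R\<close> gives a connected digraph with equal in- and outdegrees, and an
  Euler circuit of it is a periodic assignment of period \<open>|V| |R|\<close>. It is balanced because the
  number of \<open>\<pi> \<in> V\<close> with \<open>\<pi> i = k\<close> does not change along the walk of \<open>j\<close> through \<open>U\<close>, hence
  does not depend on \<open>i \<in> U\<close>.
\<close>

section \<open>Limit frequencies of periodic sequences\<close>

text \<open>The count up to \<open>t\<close> differs from a linear function of \<open>t\<close> by
  the \<open>h\<close>-periodic, hence bounded, function \<open>g\<close>; this error vanishes after
  division by \<open>t\<close>.\<close>

lemma periodic_count_limit:
  fixes P :: "nat \<Rightarrow> bool"
  assumes "h > 0" and per: "\<And>r. r \<ge> 1 \<Longrightarrow> P (r + h) = P r"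
  shows "(\<lambda>t. 1 / real t * real (card {r \<in> {1..t}. P r}))
           \<longlonglongrightarrow> real (card {r \<in> {1..h}. P r}) / real h"
proof -
  define c where "c t = real (card {r \<in> {1..t}. P r})" for t
  define g where "g t = c t - c h / real h * real t" for t
  have c_Suc: "c (Suc t) = c t + (if P (Suc t) then 1 else 0)" for t
  proof -
    have "{r \<in> {1..Suc t}. P r} = {r \<in> {1..t}. P r} \<union> (if P (Suc t) then {Suc t} else {})"
      by (auto simp: le_Suc_eq)
    then show ?thesis by (simp add: c_def)
  qed
  have c_add: "c (t + h) = c t + c h" for t
  proof (induction t)
    case 0
    then show ?case by (simp add: c_def)
  next
    case (Suc t)
    then show ?case using per[of "Suc t"] by (simp add: c_Suc)
  qed
  have g_add: "g (t + h) = g t" for t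
    unfolding g_def c_add using \<open>h > 0\<close> by (simp add: field_simps)
  have g_add_mult: "g (t + m * h) = g t" for t m
  proof (induction m)
    case (Suc m)
    have "g (t + Suc m * h) = g ((t + m * h) + h)" by (simp add: algebra_simps)
    then show ?case using Suc by (simp only: g_add)
  qed simp
  define M where "M = Max ((\<lambda>t. \<bar>g t\<bar>) ` {..<h})"
  have g_bound: "\<bar>g t\<bar> \<le> M" for t
  proof -
    have "g t = g (t mod h)" using g_add_mult[of "t mod h" "t div h"] by simp
    moreover have "\<bar>g (t mod h)\<bar> \<le> M"
      unfolding M_def using \<open>h > 0\<close> by (intro Max_ge) auto
    ultimately show ?thesis by simp
  qed
  have "(\<lambda>t. g t / real t) \<longlonglongrightarrow> 0"
  proof (rule tendsto_0_le)
    show "(\<lambda>t. M / real t) \<longlonglongrightarrow> 0" by (rule lim_const_over_n)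
    show "\<forall>\<^sub>F t in sequentially. norm (g t / real t) \<le> norm (M / real t) * 1"
    proof (intro always_eventually allI)
      fix t
      have "\<bar>g t\<bar> \<le> \<bar>M\<bar>" using g_bound[of t] by linarith
      then show "norm (g t / real t) \<le> norm (M / real t) * 1"
        by (simp add: abs_divide divide_right_mono)
    qed
  qed
  then have "(\<lambda>t. c h / real h + g t / real t) \<longlonglongrightarrow> c h / real h + 0"
    by (intro tendsto_intros)
  moreover have "\<forall>\<^sub>F t in sequentially. c h / real h + g t / real t = 1 / real t * c t"
    using eventually_gt_at_top[of 0] by eventually_elim (simp add: g_def field_simps)
  ultimately have "(\<lambda>t. 1 / real t * c t) \<longlonglongrightarrow> c h / real h"
    by (simp add: tendsto_cong)
  then show ?thesis by (simp add: c_def)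
qed

section \<open>Euler circuits from families of permutations\<close>

lemma (in pre_digraph) cas_nth_head:
  assumes "cas u p v" "k < length p"
  shows "head G (p ! k) = (if Suc k < length p then tail G (p ! Suc k) else v)"
  using assms
proof (induction p arbitrary: u k)
  case (Cons e es)
  show ?case
  proof (cases k)
    case 0
    then show ?thesis using Cons.prems by (cases es) auto
  next
    case (Suc l)
    then show ?thesis using Cons.prems Cons.IH[of "head G e" l] by auto
  qed
qed simp

text \<open>Let each pair \<open>(y, w)\<close> be an arc from \<open>y\<close> to
  \<open>act w y\<close>. Since every \<open>act w\<close> permutes \<open>V\<close>, all in- and
  outdegrees equal \<open>card R\<close>; reachability from \<open>x\<close> gives connectedness.
  The list \<open>p\<close> is an Euler circuit of this digraph.\<close>

lemma cyclic_sequence_of_permutations: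
  fixes act :: "'b \<Rightarrow> 'a \<Rightarrow> 'a"
  assumes fin: "finite V" "finite R" and "R \<noteq> {}" and "x \<in> V"
    and bij: "\<And>w. w \<in> R \<Longrightarrow> bij_betw (act w) V V"
    and reach: "\<And>v. v \<in> V \<Longrightarrow> (x, v) \<in> {(y, act w y) | y w. y \<in> V \<and> w \<in> R}\<^sup>*"
  obtains p where "distinct p" "set p = V \<times> R"
    "\<And>k. k < length p \<Longrightarrow>
       act (snd (p ! k)) (fst (p ! k)) = fst (p ! (Suc k mod length p))"
proof -
  define G where "G = \<lparr>verts = V, arcs = V \<times> R, tail = fst, head = \<lambda>(y, w). act w y\<rparr>"
  have act_in: "act w y \<in> V" if "y \<in> V" "w \<in> R" for y w
    using bij_betw_apply[OF bij] that by blast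
  interpret fin_digraph G
    by unfold_locales (use fin act_in in \<open>auto simp: G_def\<close>)
  have ends: "arcs_ends G = {(y, act w y) | y w. y \<in> V \<and> w \<in> R}"
    unfolding arcs_ends_conv by (force simp: G_def)
  have reachG: "x \<rightarrow>\<^sup>*\<^bsub>G\<^esub> v" if "v \<in> V" for v
    using reach[OF that] unfolding ends[symmetric]
  proof (induction rule: rtrancl_induct)
    case base
    show ?case using \<open>x \<in> V\<close> by (intro reachable_refl) (simp add: G_def)
  next
    case (step y z)
    then show ?case by (blast intro: reachable_adj_trans)
  qed
  have "connected G"
  proof (rule connectedI)
    show "verts G \<noteq> {}" using \<open>x \<in> V\<close> by (auto simp: G_def)
    \<comment> \<open>Connectedness refers to the symmetric closure, where a path from
      \<open>x\<close> to \<open>u\<close> can be reversed and joined to one from \<open>x\<close>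
      to \<open>v\<close>.\<close>
    interpret S: pair_wf_digraph "mk_symmetric G" ..
    fix u v assume "u \<in> verts G" "v \<in> verts G"
    then have "u \<in> V" "v \<in> V" by (simp_all add: G_def)
    then have "x \<rightarrow>\<^sup>*\<^bsub>mk_symmetric G\<^esub> u" "x \<rightarrow>\<^sup>*\<^bsub>mk_symmetric G\<^esub> v"
      by (blast intro: reachable_mk_symmetricI reachG)+
    then show "u \<rightarrow>\<^sup>*\<^bsub>mk_symmetric G\<^esub> v"
      by (rule S.reachable_trans[OF symmetric_reachable[OF symmetric_mk_symmetric]])
  qed
  moreover have "in_degree G u = out_degree G u" if "u \<in> verts G" for u
  proof -
    have u: "u \<in> V" using that by (simp add: G_def)
    have "out_arcs G u = Pair u ` R" using u by (auto simp: out_arcs_def G_def)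
    then have "out_degree G u = card R"
      by (simp add: out_degree_def card_image inj_on_def)
    \<comment> \<open>Each \<open>w\<close> contributes exactly one incoming arc, whose tail is the
      preimage of \<open>u\<close> under \<open>act w\<close>.\<close>
    moreover have "in_arcs G u = (\<lambda>w. (inv_into V (act w) u, w)) ` R"
    proof (intro equalityI subsetI)
      fix e assume "e \<in> in_arcs G u"
      then obtain y w where "e = (y, w)" "y \<in> V" "w \<in> R" "act w y = u"
        by (auto simp: G_def)
      then show "e \<in> (\<lambda>w. (inv_into V (act w) u, w)) ` R"
        using bij[of w] by (intro image_eqI[of _ _ w]) (auto simp: bij_betw_def inv_into_f_f)
    next
      fix e assume "e \<in> (\<lambda>w. (inv_into V (act w) u, w)) ` R"
      then obtain w where w: "w \<in> R" "e = (inv_into V (act w) u, w)" by auto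
      then have "u \<in> act w ` V" using bij[of w] u by (simp add: bij_betw_def)
      then show "e \<in> in_arcs G u"
        using w by (auto simp: G_def inv_into_into f_inv_into_f)
    qed
    then have "in_degree G u = card R"
      by (simp add: in_degree_def card_image inj_on_def)
    ultimately show ?thesis by simp
  qed
  ultimately obtain u p where "euler_trail u p u" using closed_euler1 by blast
  then have p: "distinct p" "set p = arcs G" "cas u p u"
    by (simp_all add: euler_trail_def trail_def awalk_def)
  then have set_p: "set p = V \<times> R" by (simp add: G_def)
  have "p \<noteq> []" using set_p \<open>x \<in> V\<close> \<open>R \<noteq> {}\<close> by auto
  then have "tail G (p ! 0) = u" using p(3) by (cases p) auto
  then have u: "fst (p ! 0) = u" by (simp add: G_def)
  show ?thesis
  proof (rule that[OF p(1) set_p])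
    fix k assume k: "k < length p"
    have "head G (p ! k) = (if Suc k < length p then fst (p ! Suc k) else u)"
      using cas_nth_head[OF p(3) k] by (simp add: G_def)
    also have "\<dots> = fst (p ! (Suc k mod length p))"
    proof (cases "Suc k < length p")
      case False
      then have "Suc k = length p" using k by simp
      then show ?thesis using u by simp
    qed simp
    finally show "act (snd (p ! k)) (fst (p ! k)) = fst (p ! (Suc k mod length p))"
      by (simp add: G_def case_prod_beta)
  qed
qed

section \<open>Bijections between the tasks at time 0 and the workers\<close>

text \<open>Injections between finite sets of equal size are bijections, so they are counted by a
  falling factorial, here a full one.\<close>

lemma card_extensional_bijections:
  assumes "finite A" "finite B" "card A = card B"
  shows "card {f \<in> A \<rightarrow>\<^sub>E B. bij_betw f A B} = fact (card A)"
proof -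
  have "f ` A = B" if "f \<in> A \<rightarrow>\<^sub>E B" "inj_on f A" for f
    using that assms by (intro card_subset_eq) (auto simp: card_image)
  then have "{f \<in> A \<rightarrow>\<^sub>E B. bij_betw f A B} = {f \<in> A \<rightarrow>\<^sub>E B. inj_on f A}"
    by (auto simp: bij_betw_def)
  moreover have "prod ((-) (card B)) {0..<card A} = fact (card A)"
    using assms(3) by (simp add: fact_prod_rev)
  ultimately show ?thesis
    using card_inj_on_subset_funcset[OF assms(1,2) subset_refl] by simp
qed

text \<open>The only use of non-overlap: all tasks in \<^term>\<open>U_set n s\<close> contain the time 0.\<close>

lemma feasible_bij_betw_U_set:
  assumes inst: "extended_instance n s e q S" and card: "card (U_set n s) = q"
    and f: "assignment n q f" "feasible n s q S f" and r: "r \<ge> 1"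
  shows "bij_betw (\<lambda>i. f (i, r)) (U_set n s) {1..q}"
proof -
  have range: "(\<lambda>i. f (i, r)) ` U_set n s \<subseteq> {1..q}"
    using f(1) r unfolding assignment_def U_set_def by (force simp: Pi_iff)
  have "inj_on (\<lambda>i. f (i, r)) (U_set n s)"
  proof (rule inj_onI, rule ccontr)
    fix i i' assume i: "i \<in> U_set n s" "i' \<in> U_set n s" "f (i, r) = f (i', r)" "i \<noteq> i'"
    have "f (i, r) \<in> {1..q}" using range i by auto
    then have "induced_schedule n s f (f (i, r)) r \<in> S"
      using f(2) r by (auto simp: feasible_def)
    then have "non_overlapping s e (induced_schedule n s f (f (i, r)) r)"
      using inst by (auto simp: extended_instance_def)
    moreover have "i \<in> fst (induced_schedule n s f (f (i, r)) r)"
      "i' \<in> fst (induced_schedule n s f (f (i, r)) r) - {i}"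
      using i by (auto simp: induced_schedule_def U_set_def)
    ultimately have "{s i..<e i} \<inter> {s i'..<e i'} = {}"
      unfolding non_overlapping_def split_beta by blast
    moreover have "0 \<in> {s i..<e i}" "0 \<in> {s i'..<e i'}"
      using i U_set_iff_zero_mem[of n s e] inst unfolding extended_instance_def by blast+
    ultimately show False by blast
  qed
  moreover from this have "(\<lambda>i. f (i, r)) ` U_set n s = {1..q}"
    using range card by (intro card_subset_eq) (simp_all add: card_image)
  ultimately show ?thesis by (simp add: bij_betw_def)
qed


section \<open>Construction of the periodic balanced assignment\<close>

text \<open>Each worker in each week of \<open>g\<close> copies some worker in some week of
  \<open>f\<close>, so feasibility is inherited. The order of these weeks comes from an Euler
  circuit.\<close>

lemma periodic_balanced_assignment:
  assumes inst: "extended_instance n s e q S" and card_U: "card (U_set n s) = q"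
    and f: "assignment n q f" "feasible n s q S f"
    and j: "j \<in> {1..q}" and all_tasks: "\<And>i. i \<in> {1..n} \<Longrightarrow> \<exists>r\<ge>1. f (i, r) = j"
  obtains g h where "assignment n q g" "feasible n s q S g" "balanced n q g"
    "periodic n g h" "h \<le> q\<^sup>2 * fact q"
proof -
  define U where "U = U_set n s"
  \<comment> \<open>The task of \<open>U\<close> that worker \<open>k\<close> performs in week
    \<open>r\<close>; it serves as a name for \<open>k\<close> in that week.\<close>
  define u where "u k r = inv_into U (\<lambda>i. f (i, r)) k" for k r
  have "q > 0" using inst by (simp add: extended_instance_def)
  have U_sub: "U \<subseteq> {1..n}" by (auto simp: U_def U_set_def)
  then have fin_U: "finite U" by (rule finite_subset) simp
  have f_bij: "bij_betw (\<lambda>i. f (i, r)) U {1..q}" if "r \<ge> 1" for r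
    unfolding U_def using feasible_bij_betw_U_set[OF inst card_U f that] .
  have f_in: "f (i, r) \<in> {1..q}" if "i \<in> {1..n}" "r \<ge> 1" for i r
    using f(1) that by (force simp: assignment_def Pi_iff)
  have u_bij: "bij_betw (\<lambda>k. u k r) {1..q} U" if "r \<ge> 1" for r
    unfolding u_def by (rule bij_betw_inv_into[OF f_bij[OF that]])
  have f_u: "f (u k r, r) = k" if "r \<ge> 1" "k \<in> {1..q}" for k r
    unfolding u_def using bij_betw_inv_into_right[OF f_bij] that by blast
  have u_f: "u (f (i, r)) r = i" if "r \<ge> 1" "i \<in> U" for i r
    unfolding u_def using bij_betw_inv_into_left[OF f_bij] that by blast
  have u_in: "u k r \<in> U" if "r \<ge> 1" "k \<in> {1..q}" for k r
    using bij_betw_apply[OF u_bij] that by blast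

  \<comment> \<open>Week patterns independent of the names of the workers\<close>
  define c where "c w i = u (f (i, w)) w" for w i
  \<comment> \<open>This looks back in time: from a task of \<open>U\<close> in week
    \<open>w + 1\<close> to the task of \<open>U\<close> done in week \<open>w\<close> by the same
    worker.\<close>
  define d where "d w i = u (f (i, w + 1)) w" for w i
  have c_in: "c w i \<in> U" if "w \<ge> 1" "i \<in> {1..n}" for w i
    unfolding c_def using that by (intro u_in f_in)
  have c_U: "c w i = i" if "w \<ge> 1" "i \<in> U" for w i
    unfolding c_def using that by (rule u_f)
  have d_bij: "bij_betw (d w) U U" if "w \<ge> 1" for w
    using bij_betw_trans[OF f_bij[of "w + 1"] u_bij[OF that]] by (simp add: d_def[abs_def] o_def)
  have d_in: "d w i \<in> U" if "w \<ge> 1" "i \<in> U" for w i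
    using bij_betw_apply[OF d_bij] that by blast
  have d_u: "d w (u j (Suc w)) = u j w" if "w \<ge> 1" for w
    using f_u[of "Suc w" j] j by (simp add: d_def)

  define A where "A = (\<lambda>r. (u j r, u j (Suc r))) ` {1..}"
  \<comment> \<open>One week is chosen for each transition in \<open>A\<close>, so \<open>R\<close>
    is bounded by \<open>U \<times> U\<close> however long \<open>j\<close> takes to perform all
    tasks.\<close>
  define R where "R = inv_into {1..} (\<lambda>r. (u j r, u j (Suc r))) ` A"
  have A_sub: "A \<subseteq> U \<times> U" unfolding A_def using u_in j by auto
  then have fin_A: "finite A" by (rule finite_subset) (simp add: fin_U)
  have fin_R: "finite R" and "R \<noteq> {}" using fin_A by (auto simp: R_def A_def)
  have card_R: "card R \<le> q\<^sup>2"
  proof -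
    have "card R \<le> card A" unfolding R_def by (rule card_image_le[OF fin_A])
    also have "\<dots> \<le> card (U \<times> U)" by (rule card_mono[OF _ A_sub]) (simp add: fin_U)
    finally show ?thesis using card_U by (simp add: card_cartesian_product power2_eq_square U_def)
  qed
  have R_ge: "w \<ge> 1" if "w \<in> R" for w
    using that inv_into_into[of _ "\<lambda>r. (u j r, u j (Suc r))" "{1..}"] by (auto simp: R_def A_def)
  have R_pair: "\<exists>w\<in>R. u j w = u j r \<and> u j (Suc w) = u j (Suc r)" if "r \<ge> 1" for r
  proof -
    let ?w = "inv_into {1..} (\<lambda>r. (u j r, u j (Suc r))) (u j r, u j (Suc r))"
    have a: "(u j r, u j (Suc r)) \<in> A" using that by (auto simp: A_def)
    then have "?w \<in> R" by (auto simp: R_def)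
    moreover have "(u j ?w, u j (Suc ?w)) = (u j r, u j (Suc r))"
      using f_inv_into_f[of _ "\<lambda>r. (u j r, u j (Suc r))" "{1..}"] a unfolding A_def by blast
    ultimately show ?thesis by blast
  qed

  \<comment> \<open>The labellings of \<open>U\<close> by workers and their orbit\<close>
  define B where "B = {\<pi> \<in> U \<rightarrow>\<^sub>E {1..q}. bij_betw \<pi> U {1..q}}"
  \<comment> \<open>If \<open>\<pi>\<close> labels \<open>U\<close> in one week and the pattern of
    \<open>w\<close> is applied, this is the labelling in the next week. Restriction keeps it
    extensional, hence in the finite set \<open>B\<close>.\<close>
  define act where "act w \<pi> = restrict (\<lambda>i. \<pi> (d w i)) U" for w and \<pi> :: "nat \<Rightarrow> nat"
  have fin_B: "finite B" unfolding B_def by (simp add: finite_PiE fin_U)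
  have card_B: "card B = fact q"
    unfolding B_def using card_extensional_bijections[OF fin_U, of "{1..q}"] card_U
    by (simp add: U_def)
  have B_bij: "bij_betw \<pi> U {1..q}" if "\<pi> \<in> B" for \<pi>
    using that by (simp add: B_def)
  have B_I: "restrict \<pi> U \<in> B" if "bij_betw \<pi> U {1..q}" for \<pi>
  proof -
    have "bij_betw (restrict \<pi> U) U {1..q}"
      using that bij_betw_cong[of U "restrict \<pi> U" \<pi>] by simp
    then show ?thesis using bij_betw_apply[OF that] by (auto simp: B_def)
  qed
  have act_B: "act w \<pi> \<in> B" if "w \<in> R" "\<pi> \<in> B" for w \<pi>
    unfolding act_def using bij_betw_trans[OF d_bij[OF R_ge[OF that(1)]] B_bij[OF that(2)]]
    by (intro B_I) (simp add: o_def)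
  have act_inj: "inj_on (act w) B" if "w \<in> R" for w
  proof (rule inj_onI)
    fix \<pi> \<rho> assume \<pi>\<rho>: "\<pi> \<in> B" "\<rho> \<in> B" "act w \<pi> = act w \<rho>"
    have "\<pi> i = \<rho> i" if i: "i \<in> U" for i
    proof -
      have "i \<in> d w ` U" using d_bij[OF R_ge[OF \<open>w \<in> R\<close>]] i by (simp add: bij_betw_def)
      then obtain i' where "i' \<in> U" "i = d w i'" by blast
      then show ?thesis using fun_cong[OF \<pi>\<rho>(3), of i'] by (simp add: act_def)
    qed
    then show "\<pi> = \<rho>" using \<pi>\<rho>(1,2) by (auto simp: B_def intro: PiE_ext)
  qed

  define \<pi>\<^sub>0 where "\<pi>\<^sub>0 = restrict (\<lambda>i. f (i, 1)) U"
  define V where "V = {\<pi>. (\<pi>\<^sub>0, \<pi>) \<in> {(\<rho>, act w \<rho>) | \<rho> w. \<rho> \<in> B \<and> w \<in> R}\<^sup>*}"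
  have "\<pi>\<^sub>0 \<in> V" by (simp add: V_def)
  have "\<pi>\<^sub>0 \<in> B" unfolding \<pi>\<^sub>0_def using f_bij[of 1] by (intro B_I) simp
  have V_B: "V \<subseteq> B"
  proof
    fix \<pi> assume "\<pi> \<in> V"
    then have "(\<pi>\<^sub>0, \<pi>) \<in> {(\<rho>, act w \<rho>) | \<rho> w. \<rho> \<in> B \<and> w \<in> R}\<^sup>*" by (simp add: V_def)
    then show "\<pi> \<in> B" by (cases rule: rtranclE) (use \<open>\<pi>\<^sub>0 \<in> B\<close> act_B in auto)
  qed
  then have fin_V: "finite V" using fin_B by (rule finite_subset)
  have act_V: "act w \<pi> \<in> V" if "w \<in> R" "\<pi> \<in> V" for w \<pi>
  proof -
    have "(\<pi>, act w \<pi>) \<in> {(\<rho>, act w \<rho>) | \<rho> w. \<rho> \<in> B \<and> w \<in> R}" using that V_B by blast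
    then show ?thesis using that(2) unfolding V_def by (simp add: rtrancl_into_rtrancl)
  qed
  \<comment> \<open>The orbit is closed only under forward steps, but an injective self-map of a
    finite set is onto.\<close>
  have act_bij: "bij_betw (act w) V V" if "w \<in> R" for w
  proof -
    have "inj_on (act w) V" using act_inj[OF that] V_B by (rule inj_on_subset)
    moreover from this have "act w ` V = V"
      using act_V[OF that] by (intro endo_inj_surj[OF fin_V]) auto
    ultimately show ?thesis by (simp add: bij_betw_def)
  qed
  have V_reach: "(\<pi>\<^sub>0, \<pi>) \<in> {(\<rho>, act w \<rho>) | \<rho> w. \<rho> \<in> V \<and> w \<in> R}\<^sup>*" if "\<pi> \<in> V" for \<pi>
  proof -
    have "(\<pi>\<^sub>0, \<pi>) \<in> {(\<rho>, act w \<rho>) | \<rho> w. \<rho> \<in> B \<and> w \<in> R}\<^sup>*" using that by (simp add: V_def)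
    then show ?thesis
    proof (induction rule: rtrancl_induct)
      case (step \<rho> \<tau>)
      then have "\<rho> \<in> V" by (simp add: V_def)
      then have "(\<rho>, \<tau>) \<in> {(\<rho>, act w \<rho>) | \<rho> w. \<rho> \<in> V \<and> w \<in> R}" using step(2) by blast
      then show ?case using step.IH by (rule rtrancl_into_rtrancl[rotated])
    qed simp
  qed

  \<comment> \<open>Equal distribution of labels over the orbit\<close>
  define N where "N i k = card {\<pi> \<in> V. \<pi> i = k}" for i k :: nat
  \<comment> \<open>The permutation \<open>act w\<close> of \<open>V\<close> carries the labellings
    with label \<open>k\<close> at \<open>d w i\<close> to those with label \<open>k\<close> at
    \<open>i\<close>.\<close>
  have N_d: "N (d w i) k = N i k" if "w \<in> R" "i \<in> U" for w i k
  proof -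
    have "act w ` {\<pi> \<in> V. \<pi> (d w i) = k} = {\<pi> \<in> act w ` V. \<pi> i = k}"
      using that(2) by (auto simp: act_def)
    also have "act w ` V = V" using act_bij[OF that(1)] by (simp add: bij_betw_def)
    finally have "bij_betw (act w) {\<pi> \<in> V. \<pi> (d w i) = k} {\<pi> \<in> V. \<pi> i = k}"
      by (intro bij_betw_subset[OF act_bij[OF that(1)]]) auto
    then show ?thesis unfolding N_def by (rule bij_betw_same_card)
  qed
  \<comment> \<open>Week \<open>r\<close> itself may lie outside \<open>R\<close>, but its
    transition of \<open>j\<close> has a representative \<open>w\<close> there, and
    \<open>d w\<close> realizes that transition backwards.\<close>
  have N_Suc: "N (u j (Suc r)) k = N (u j r) k" if "r \<ge> 1" for r k
  proof -
    obtain w where "w \<in> R" "u j w = u j r" "u j (Suc w) = u j (Suc r)"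
      using R_pair[OF \<open>r \<ge> 1\<close>] by blast
    then show ?thesis using N_d[of w "u j (Suc w)" k] d_u[of w] R_ge u_in j by auto
  qed
  have N_walk: "N (u j r) k = N (u j 1) k" if "r \<ge> 1" for r k
    using that by (induction r rule: dec_induct) (simp_all add: N_Suc)
  have N_const: "N i k = N (u j 1) k" if i: "i \<in> U" for i k
  proof -
    obtain r where "r \<ge> 1" "f (i, r) = j" using all_tasks U_sub i by blast
    then show ?thesis using u_f[of r i] i N_walk[of r k] by simp
  qed
  have N_eq: "q * N i k = card V" if "i \<in> U" "k \<in> {1..q}" for i k
  proof -
    \<comment> \<open>Double counting: every labelling uses \<open>k\<close> exactly once, and the
      \<open>q\<close> numbers \<open>N i' k\<close> coincide.\<close>
    have "card V = (\<Sum>\<pi>\<in>V. card {i' \<in> U. \<pi> i' = k})"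
    proof -
      have "card {i' \<in> U. \<pi> i' = k} = 1" if "\<pi> \<in> V" for \<pi>
      proof -
        have b: "bij_betw \<pi> U {1..q}" using B_bij V_B that by blast
        then have "k \<in> \<pi> ` U" using \<open>k \<in> {1..q}\<close> by (simp add: bij_betw_def)
        then obtain a where "a \<in> U" "\<pi> a = k" by blast
        then have "{i' \<in> U. \<pi> i' = k} = {a}"
          using b by (auto simp: bij_betw_def inj_on_def)
        then show ?thesis by simp
      qed
      then show ?thesis by simp
    qed
    also have "\<dots> = (\<Sum>i'\<in>U. N i' k)"
      unfolding N_def by (rule sum_multicount_gen) (use fin_V fin_U in auto)
    also have "\<dots> = (\<Sum>i'\<in>U. N i k)"
      using N_const that by (intro sum.cong) auto
    finally show ?thesis using card_U by (simp add: U_def)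
  qed

  \<comment> \<open>The assignment read off the Euler circuit\<close>
  obtain p where p: "distinct p" "set p = V \<times> R"
    and p_Suc: "\<And>m. m < length p \<Longrightarrow>
       act (snd (p ! m)) (fst (p ! m)) = fst (p ! (Suc m mod length p))"
    using cyclic_sequence_of_permutations[OF fin_V fin_R \<open>R \<noteq> {}\<close> \<open>\<pi>\<^sub>0 \<in> V\<close> act_bij V_reach]
    by blast
  define h where "h = length p"
  have h: "h = card V * card R"
    unfolding h_def using distinct_card[OF p(1)] p(2) by (simp add: card_cartesian_product)
  have "card V > 0" "card R > 0"
    using fin_V fin_R \<open>\<pi>\<^sub>0 \<in> V\<close> \<open>R \<noteq> {}\<close> by (auto simp: card_gt_0_iff)
  then have "h > 0" by (simp add: h)
  \<comment> \<open>Weeks start at 1 and list positions at 0, hence the shift. The arc of week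
    \<open>r\<close> consists of the labelling \<open>y r\<close> and the week \<open>w r\<close> of
    \<open>f\<close> to be copied.\<close>
  define y where "y r = fst (p ! ((r - 1) mod h))" for r
  define w where "w r = snd (p ! ((r - 1) mod h))" for r
  have yw: "y r \<in> V" "w r \<in> R" for r
  proof -
    have "p ! ((r - 1) mod h) \<in> set p" using \<open>h > 0\<close> by (simp add: h_def)
    then show "y r \<in> V" "w r \<in> R" by (auto simp: p(2) y_def w_def mem_Times_iff)
  qed
  have w_ge: "w r \<ge> 1" for r using R_ge yw(2) .
  have y_bij: "bij_betw (y r) U {1..q}" for r using B_bij V_B yw(1) by blast
  have y_Suc: "y (r + 1) i = y r (d (w r) i)" if "r \<ge> 1" "i \<in> U" for r i
  proof -
    have "y (r + 1) = fst (p ! (Suc ((r - 1) mod h) mod h))"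
      using that(1) by (simp add: y_def mod_Suc_eq)
    also have "\<dots> = act (w r) (y r)"
      using p_Suc[of "(r - 1) mod h"] \<open>h > 0\<close> by (simp add: h_def y_def w_def)
    finally show ?thesis using that(2) by (simp add: act_def)
  qed
  \<comment> \<open>Task \<open>i\<close> goes to the label of the task of \<open>U\<close> whose
    worker also performs \<open>i\<close> in week \<open>w r\<close> of \<open>f\<close>.\<close>
  define g where "g = (\<lambda>(i, r). y r (c (w r) i))"
  have g: "g (i, r) = y r (c (w r) i)" for i r by (simp add: g_def)

  have assg: "assignment n q g"
    using bij_betw_apply[OF y_bij] c_in w_ge by (fastforce simp: assignment_def g)
  have feas: "feasible n s q S g"
    unfolding feasible_def
  proof (intro ballI allI impI)
    fix k r :: nat assume k: "k \<in> {1..q}" and r: "1 \<le> r"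
    \<comment> \<open>With \<open>a\<close> the task of \<open>U\<close> labelled \<open>k\<close>,
      worker \<open>k\<close> plays in week \<open>r\<close> the role of worker
      \<open>f (a, w r)\<close> in week \<open>w r\<close>; \<open>y_Suc\<close> ensures that this
      includes the passage to the next week.\<close>
    have "k \<in> y r ` U" using y_bij[of r] k by (simp add: bij_betw_def)
    then obtain a where a: "a \<in> U" "y r a = k" by blast
    have y_iff: "y r b = k \<longleftrightarrow> b = a" if "b \<in> U" for b
      using y_bij[of r] a that by (auto simp: bij_betw_def inj_on_def)
    have u_iff: "u l (w r) = a \<longleftrightarrow> l = f (a, w r)" if "l \<in> {1..q}" for l
      using f_u[OF w_ge that] u_f[OF w_ge a(1)] by auto
    have "g (i, r) = k \<longleftrightarrow> f (i, w r) = f (a, w r)" if "i \<in> {1..n}" for i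
      using y_iff[OF c_in[OF w_ge that]] u_iff[OF f_in[OF that w_ge]] by (simp add: g c_def)
    moreover have "g (i, r + 1) = k \<longleftrightarrow> f (i, w r + 1) = f (a, w r)" if "i \<in> U" for i
    proof -
      have "f (i, w r + 1) \<in> {1..q}" using f_in that U_sub by auto
      then show ?thesis
        using y_iff[OF d_in[OF w_ge that]] u_iff[of "f (i, w r + 1)"] y_Suc[OF r that]
          c_U[OF w_ge that] by (simp add: g d_def)
    qed
    ultimately have "induced_schedule n s g k r = induced_schedule n s f (f (a, w r)) (w r)"
      by (auto simp: induced_schedule_def U_def)
    moreover have "f (a, w r) \<in> {1..q}" using f_in U_sub a(1) w_ge by auto
    ultimately show "induced_schedule n s g k r \<in> S"
      using f(2) w_ge by (auto simp: feasible_def)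
  qed
  have g_add: "g (i, r + h) = g (i, r)" if "r \<ge> 1" for i r
  proof -
    \<comment> \<open>Here \<open>r \<ge> 1\<close> keeps the truncated subtraction from distorting
      the shift.\<close>
    have "(r + h - 1) mod h = (r - 1) mod h"
      using that by (metis Nat.add_diff_assoc2 mod_add_self2)
    then show ?thesis by (simp add: g y_def w_def)
  qed
  have bal: "balanced n q g"
    unfolding balanced_def
  proof (intro ballI)
    fix i k assume i: "i \<in> {1..n}" and k: "k \<in> {1..q}"
    have "(\<lambda>r. p ! ((r - 1) mod h)) ` {1..h} = set p" (is "?e ` _ = _")
    proof -
      have "?e ` {1..h} = (!) p ` {..<h}"
      proof (intro equalityI subsetI)
        fix a assume "a \<in> (!) p ` {..<h}"
        then obtain m where "m < h" "a = p ! m" by auto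
        then show "a \<in> ?e ` {1..h}" by (intro image_eqI[of _ _ "Suc m"]) auto
      qed (use \<open>h > 0\<close> in auto)
      then show ?thesis by (auto simp: h_def set_conv_nth)
    qed
    \<comment> \<open>One period runs through every arc once: \<open>?e\<close> is onto a set of the
      same size \<open>h\<close>.\<close>
    then have e_bij: "bij_betw ?e {1..h} (V \<times> R)"
      using h p(2) by (auto simp: bij_betw_def card_cartesian_product intro!: eq_card_imp_inj_on)
    have "bij_betw ?e {r \<in> {1..h}. g (i, r) = k} {a \<in> V \<times> R. fst a (c (snd a) i) = k}"
    proof (rule bij_betw_subset[OF e_bij])
      have "?e ` {r \<in> {1..h}. fst (?e r) (c (snd (?e r)) i) = k}
        = {a \<in> ?e ` {1..h}. fst a (c (snd a) i) = k}" by blast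
      then show "?e ` {r \<in> {1..h}. g (i, r) = k} = {a \<in> V \<times> R. fst a (c (snd a) i) = k}"
        using e_bij by (simp add: bij_betw_def g y_def w_def)
    qed auto
    then have "card {r \<in> {1..h}. g (i, r) = k} = card {a \<in> V \<times> R. fst a (c (snd a) i) = k}"
      by (rule bij_betw_same_card)
    \<comment> \<open>Grouping the arcs by the copied week \<open>v\<close> gives
      \<open>card R\<close> terms, each equal to \<open>card V / q\<close> by
      \<open>N_eq\<close>.\<close>
    also have "\<dots> = (\<Sum>v\<in>R. N (c v i) k)"
    proof -
      have "{a \<in> V \<times> R. fst a (c (snd a) i) = k}
          = (\<lambda>(v, \<pi>). (\<pi>, v)) ` (SIGMA v:R. {\<pi> \<in> V. \<pi> (c v i) = k})" by force
      then show ?thesis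
        using fin_R fin_V by (simp add: card_image inj_on_def card_SigmaI N_def split_beta)
    qed
    finally have "q * card {r \<in> {1..h}. g (i, r) = k} = (\<Sum>v\<in>R. q * N (c v i) k)"
      by (simp add: sum_distrib_left)
    also have "\<dots> = (\<Sum>v\<in>R. card V)"
      using N_eq c_in R_ge i k by (intro sum.cong) auto
    finally have "q * card {r \<in> {1..h}. g (i, r) = k} = h" by (simp add: h)
    then have "real q * real (card {r \<in> {1..h}. g (i, r) = k}) = real h"
      by (metis of_nat_mult)
    then have "real (card {r \<in> {1..h}. g (i, r) = k}) / real h = 1 / real q"
      using \<open>h > 0\<close> \<open>q > 0\<close> by (simp add: field_simps)
    then show "(\<lambda>t. 1 / real t * real (card {r \<in> {1..t}. g (i, r) = k})) \<longlonglongrightarrow> 1 / real q"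
      using periodic_count_limit[OF \<open>h > 0\<close>, of "\<lambda>r. g (i, r) = k"] g_add by simp
  qed
  have "periodic n g h" using g_add \<open>h > 0\<close> by (simp add: periodic_def)
  moreover have "h \<le> q\<^sup>2 * fact q"
    using mult_le_mono[OF card_R card_mono[OF fin_B V_B]] by (simp add: h card_B mult.commute)
  ultimately show ?thesis using that assg feas bal by blast
qed

section \<open>Equivalence of the three statements\<close>

text \<open>If \<open>j\<close> never performed \<open>i\<close>, all frequencies would be 0 and
  could not tend to \<open>1 / q\<close>.\<close>

lemma balanced_imp_performs:
  assumes "balanced n q f" "q > 0" "i \<in> {1..n}" "j \<in> {1..q}"
  shows "\<exists>r\<ge>1. f (i, r) = j"
proof (rule ccontr)
  assume none: "\<not> (\<exists>r\<ge>1. f (i, r) = j)"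
  have "(\<lambda>t. 1 / real t * real (card {r \<in> {1..t}. f (i, r) = j})) \<longlonglongrightarrow> 1 / real q"
    using assms by (auto simp: balanced_def)
  moreover have "{r \<in> {1..t}. f (i, r) = j} = {}" for t using none by auto
  ultimately have "(\<lambda>t. 0 :: real) \<longlonglongrightarrow> 1 / real q" by (simp only:) simp
  then have "1 / real q = 0" using LIMSEQ_unique tendsto_const by blast
  then show False using \<open>q > 0\<close> by simp
qed

theorem theorem1p4:
  fixes n q :: nat and s e :: "nat \<Rightarrow> real" and S :: "schedule set"
  assumes "extended_instance n s e q S"
    and "card (U_set n s) = q"
  shows "((\<exists>f. assignment n q f \<and> feasible n s q S f \<and>
             (\<exists>j\<in>{1..q}. \<forall>i\<in>{1..n}. \<exists>r\<ge>1. f (i, r) = j))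
          \<longleftrightarrow> (\<exists>f. assignment n q f \<and> feasible n s q S f \<and> balanced n q f))
       \<and> ((\<exists>f. assignment n q f \<and> feasible n s q S f \<and> balanced n q f)
          \<longleftrightarrow> (\<exists>f h. assignment n q f \<and> feasible n s q S f \<and> balanced n q f \<and>
                 periodic n f h \<and> h \<le> q\<^sup>2 * fact q))"
    (is "(?a \<longleftrightarrow> ?b) \<and> (?b \<longleftrightarrow> ?c)")
proof -
  have "q > 0" using assms(1) by (simp add: extended_instance_def)
  have "?a \<Longrightarrow> ?c"
  proof -
    assume ?a
    then obtain f j where f: "assignment n q f" "feasible n s q S f" "j \<in> {1..q}"
      and all_tasks: "\<And>i. i \<in> {1..n} \<Longrightarrow> \<exists>r\<ge>1. f (i, r) = j" by blast
    obtain g h where "assignment n q g" "feasible n s q S g" "balanced n q g"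
      "periodic n g h" "h \<le> q\<^sup>2 * fact q"
      using periodic_balanced_assignment[OF assms f all_tasks] .
    then show ?c by blast
  qed
  moreover have "?c \<Longrightarrow> ?b" by blast
  moreover have "?b \<Longrightarrow> ?a"
  proof -
    assume ?b
    then obtain f where f: "assignment n q f" "feasible n s q S f" "balanced n q f" by blast
    have "1 \<in> {1..q}" using \<open>q > 0\<close> by simp
    then show ?a using f balanced_imp_performs[OF f(3) \<open>q > 0\<close>] by blast
  qed
  ultimately show ?thesis by blast
qed

end
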